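(* Let $\mathcal{D}_1=(V,E_1)$ and $\mathcal{D}_2=(V,E_2)$ be cDGs, both containing all loops, with the same directed edges. Then $\mathcal{D}_1$ and $\mathcal{D}_2$ are Markov equivalent if and only if for every ancestral set $A\subseteq V$ the induced graphs $(\mathcal{D}_1)_A$ and $(\mathcal{D}_2)_A$ have the same collider connections.
   Context: **Graphs.** A directed correlation graph (cDG) is a graph $(V,E)$ with finite node set whose edges are either directed, $\alpha\to\beta$ (loops $\alpha\to\alpha$ allowed; $\alpha\to\beta$ and $\beta\to\alpha$ are different edges), or blunt, $\alpha\vdash\!\dashv\beta$ (unordered, $\alpha\ne\beta$). Several edges of different kinds between the same two nodes are allowed. It contains all loops if $\alpha\to\alpha$ is an edge for all $\alpha\in V$. For $A\subseteq V$, the induced graph $\mathcal{D}_A$ has node set $A$ and all edges of $\mathcal{D}$ between nodes of $A$. A walk is an alternating sequence $\gamma_1,e_1,\gamma_2,\dots,e_k,\gamma_{k+1}$ of nodes and edges with $e_i$ an edge between $\gamma_i$ and $\gamma_{i+1}$, the direction of every directed edge (including loops) along the walk being specified; it is nontrivial if $k\ge 1$. The edge $\alpha\to\beta$ has a head at $\beta$ and a tail at $\alpha$; the edge $\alpha\vdash\!\dashv\beta$ has a stump at both ends; an edge has a neck at a node if it has a head or a stump there. A nonendpoint node (instance) $\gamma_i$, $1<i<k+1$, is a collider on the walk if both $e_{i-1}$ and $e_i$ have a neck at $\gamma_i$, and otherwise a noncollider. Nodes $\alpha$ and $\beta$ are collider connected if there is a walk from $\alpha$ to $\beta$ on which every nonendpoint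 node is a collider. Two graphs on the same node set have the same collider connections if for all nodes $\alpha,\beta$: $\alpha$ and $\beta$ are collider connected in one iff they are in the other. $\mathrm{an}(C)$ is the set of nodes from which there is a (possibly trivial) directed path to some node in $C$. A set $A\subseteq V$ is ancestral if $A=\mathrm{an}(A)$ (since the directed edges agree, this is the same in $\mathcal{D}_1$ and $\mathcal{D}_2$). **$\mu$-separation and Markov equivalence.** A nontrivial walk from $\alpha$ to $\beta$ is $\mu$-connecting given $C\subseteq V$ if $\alpha\notin C$, every collider is in $\mathrm{an}(C)$, no noncollider is in $C$, and the final edge has a head at $\beta$. For $A,B,C\subseteq V$, $B$ is $\mu$-separated from $A$ given $C$ if there is no $\mu$-connecting walk from any $\alpha\in A$ to any $\beta\in B$ given $C$. $\mathcal{I}(\mathcal{D})$ is the set of triples $(A,B,C)$ of subsets of $V$ such that $B$ is $\mu$-separated from $A$ given $C$ in $\mathcal{D}$. $\mathcal{D}_1,\mathcal{D}_2$ are Markov equivalent if $\mathcal{I}(\mathcal{D}_1)=\mathcal{I}(\mathcal{D}_2)$. *)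

theory Defs
  imports Main
begin

record 'v mixed_graph =
  nodes :: "'v set"
  directed :: "('v \<times> 'v) set"
  blunt :: "'v set set"

text \<open>A pair \<open>(a, b)\<close> in \<open>directed\<close> is the edge \<open>a \<rightarrow> b\<close>; a doubleton \<open>{a, b}\<close> in \<open>blunt\<close> is the
  unordered blunt edge between two distinct nodes. There is at most one edge of each kind between
  two given nodes, but edges of different kinds may coexist.\<close>

definition cDG :: "'v mixed_graph \<Rightarrow> bool" where
  "cDG G \<longleftrightarrow>
     finite (nodes G) \<and>
     directed G \<subseteq> nodes G \<times> nodes G \<and>
     (\<forall>e \<in> blunt G. \<exists>a \<in> nodes G. \<exists>b \<in> nodes G. a \<noteq> b \<and> e = {a, b})"

definition contains_all_loops :: "'v mixed_graph \<Rightarrow> bool" where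
  "contains_all_loops G \<longleftrightarrow> (\<forall>a \<in> nodes G. (a, a) \<in> directed G)"

definition induced :: "'v mixed_graph \<Rightarrow> 'v set \<Rightarrow> 'v mixed_graph" where
  "induced G A =
     \<lparr>nodes = A, directed = directed G \<inter> A \<times> A, blunt = {e \<in> blunt G. e \<subseteq> A}\<rparr>"

text \<open>A walk is given by its list of nodes \<open>ns\<close> and, for each step, the kind of edge used together
  with the direction in which a directed edge is traversed. The two endpoints and this datum
  determine the edge. In particular, a loop can be traversed \<open>Forward\<close> or \<open>Backward\<close>.\<close>

datatype step = Forward | Backward | Blunt

fun joins :: "'v mixed_graph \<Rightarrow> 'v \<Rightarrow> step \<Rightarrow> 'v \<Rightarrow> bool" where
  "joins G a Forward b \<longleftrightarrow> (a, b) \<in> directed G"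
| "joins G a Backward b \<longleftrightarrow> (b, a) \<in> directed G"
| "joins G a Blunt b \<longleftrightarrow> {a, b} \<in> blunt G"

definition walk :: "'v mixed_graph \<Rightarrow> 'v list \<Rightarrow> step list \<Rightarrow> bool" where
  "walk G ns es \<longleftrightarrow>
     length ns = Suc (length es) \<and> set ns \<subseteq> nodes G \<and>
     (\<forall>i < length es. joins G (ns ! i) (es ! i) (ns ! Suc i))"

definition walk_from_to :: "'v mixed_graph \<Rightarrow> 'v \<Rightarrow> 'v list \<Rightarrow> step list \<Rightarrow> 'v \<Rightarrow> bool" where
  "walk_from_to G a ns es b \<longleftrightarrow> walk G ns es \<and> hd ns = a \<and> last ns = b"

text \<open>Marks at the earlier (\<open>left\<close>) and the later (\<open>right\<close>) end of a step along the walk.\<close>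

definition head_left :: "step \<Rightarrow> bool" where
  "head_left e \<longleftrightarrow> e = Backward"

definition head_right :: "step \<Rightarrow> bool" where
  "head_right e \<longleftrightarrow> e = Forward"

definition stump :: "step \<Rightarrow> bool" where
  "stump e \<longleftrightarrow> e = Blunt"

definition neck_left :: "step \<Rightarrow> bool" where
  "neck_left e \<longleftrightarrow> head_left e \<or> stump e"

definition neck_right :: "step \<Rightarrow> bool" where
  "neck_right e \<longleftrightarrow> head_right e \<or> stump e"

text \<open>Being a collider is a property of a node instance, i.e. of a position in the walk, not of
  a node. Positions are counted from \<open>0\<close>, so \<open>0 < i < length es\<close> are the nonendpoint positions,
  between the steps \<open>es ! (i - 1)\<close> and \<open>es ! i\<close>.\<close>

definition nonendpoint :: "step list \<Rightarrow> nat \<Rightarrow> bool" where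
  "nonendpoint es i \<longleftrightarrow> 0 < i \<and> i < length es"

definition collider :: "step list \<Rightarrow> nat \<Rightarrow> bool" where
  "collider es i \<longleftrightarrow> nonendpoint es i \<and> neck_right (es ! (i - 1)) \<and> neck_left (es ! i)"

definition noncollider :: "step list \<Rightarrow> nat \<Rightarrow> bool" where
  "noncollider es i \<longleftrightarrow> nonendpoint es i \<and> \<not> collider es i"

text \<open>The connecting walk may be trivial, so every node is collider connected to itself.\<close>

definition collider_connected :: "'v mixed_graph \<Rightarrow> 'v \<Rightarrow> 'v \<Rightarrow> bool" where
  "collider_connected G a b \<longleftrightarrow>
     (\<exists>ns es. walk_from_to G a ns es b \<and> (\<forall>i. nonendpoint es i \<longrightarrow> collider es i))"

definition same_collider_connections :: "'v mixed_graph \<Rightarrow> 'v mixed_graph \<Rightarrow> bool" where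
  "same_collider_connections G H \<longleftrightarrow>
     nodes G = nodes H \<and>
     (\<forall>a \<in> nodes G. \<forall>b \<in> nodes G. collider_connected G a b \<longleftrightarrow> collider_connected H a b)"

definition an :: "'v mixed_graph \<Rightarrow> 'v set \<Rightarrow> 'v set" where
  "an G C = {a \<in> nodes G. \<exists>c \<in> C. (a, c) \<in> (directed G)\<^sup>*}"

definition ancestral :: "'v mixed_graph \<Rightarrow> 'v set \<Rightarrow> bool" where
  "ancestral G A \<longleftrightarrow> A \<subseteq> nodes G \<and> A = an G A"

definition mu_connecting ::
  "'v mixed_graph \<Rightarrow> 'v set \<Rightarrow> 'v \<Rightarrow> 'v list \<Rightarrow> step list \<Rightarrow> 'v \<Rightarrow> bool" where
  "mu_connecting G C a ns es b \<longleftrightarrow>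
     walk_from_to G a ns es b \<and> es \<noteq> [] \<and> a \<notin> C \<and>
     (\<forall>i. collider es i \<longrightarrow> ns ! i \<in> an G C) \<and>
     (\<forall>i. noncollider es i \<longrightarrow> ns ! i \<notin> C) \<and>
     head_right (last es)"

text \<open>\<open>mu_separated G A B C\<close>: the set \<open>B\<close> is separated from \<open>A\<close> given \<open>C\<close>. The relation is not
  symmetric in \<open>A\<close> and \<open>B\<close>.\<close>

definition mu_separated :: "'v mixed_graph \<Rightarrow> 'v set \<Rightarrow> 'v set \<Rightarrow> 'v set \<Rightarrow> bool" where
  "mu_separated G A B C \<longleftrightarrow> \<not> (\<exists>a \<in> A. \<exists>b \<in> B. \<exists>ns es. mu_connecting G C a ns es b)"

definition independence_model :: "'v mixed_graph \<Rightarrow> ('v set \<times> 'v set \<times> 'v set) set" where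
  "independence_model G =
     {(A, B, C). A \<subseteq> nodes G \<and> B \<subseteq> nodes G \<and> C \<subseteq> nodes G \<and> mu_separated G A B C}"

definition markov_equivalent :: "'v mixed_graph \<Rightarrow> 'v mixed_graph \<Rightarrow> bool" where
  "markov_equivalent G H \<longleftrightarrow> independence_model G = independence_model H"

end

theory Submission
  imports Defs
begin

text \<open>
  Both directions of the equivalence come from one description of \<open>\<mu>\<close>-connection in a cDG
  with all loops (\<open>mu_connecting_iff_links\<close>). Let \<open>A\<close> be the ancestral set generated by
  \<open>{a, b} \<union> C\<close>. Then there is a \<open>\<mu>\<close>-connecting walk from \<open>a\<close> to \<open>b\<close> given \<open>C\<close> if and
  only if \<open>a \<notin> C\<close> and one can go from \<open>a\<close> to a parent of \<open>b\<close> along a chain of nodes outside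
  \<open>C\<close> in which consecutive nodes are collider connected in the graph induced on \<open>A\<close>.
  The right-hand side refers to the graph only through its directed edges and the collider
  connections in an ancestral set, so equal collider connections imply Markov equivalence.
  Conversely, given an ancestral set \<open>A\<close> and \<open>a, b \<in> A\<close>, take \<open>C = A - {a, b}\<close>. The only
  nodes of \<open>A\<close> outside \<open>C\<close> are \<open>a\<close> and \<open>b\<close>, so every chain collapses to a collider connection
  between \<open>a\<close> and \<open>b\<close>, and the \<open>\<mu>\<close>-connection from \<open>a\<close> to \<open>b\<close> given \<open>C\<close> reveals whether
  \<open>a\<close> and \<open>b\<close> are collider connected within \<open>A\<close>.

  The loops enter as follows. An edge with a neck at both ends is blunt, so a collider walk is
  blunt apart from its two outer edges. With loops to fill in, those outer edges can always be
  chosen directed: \<open>a\<close> and \<open>b\<close> are collider connected if and only if some child of \<open>a\<close> and some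
  child of \<open>b\<close> are joined by a possibly trivial walk of blunt edges (\<open>collider_connected_iff\<close>). Consequently
  collider walks can be concatenated at a node outside \<open>C\<close> and that node becomes a noncollider.

  For the characterization, splitting a \<open>\<mu>\<close>-connecting walk at its noncolliders gives the chain,
  since all nodes of such a walk lie in \<open>A\<close>. In the other direction, concatenating the collider
  walks of a chain may give colliders in \<open>A\<close> that are not ancestors of \<open>C\<close>. Such a collider is
  an ancestor of \<open>a\<close> or of \<open>b\<close>, by a directed path that avoids \<open>C\<close>. In the first case the
  initial part of the walk is replaced by the path from \<open>a\<close> traversed against its direction; in
  the second case the walk can leave along the path and reach \<open>b\<close> at once.
\<close>

section \<open>Walks with prescribed colliders and noncolliders\<close>

text \<open>The condition for continuing a walk, whose last step so far is \<open>t\<close>, from \<open>x\<close> with step \<open>e\<close>.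
  There is none at the initial node, which is an endpoint and not yet preceded by a step.\<close>

definition passes :: "'v set \<Rightarrow> 'v set \<Rightarrow> 'v \<Rightarrow> step option \<Rightarrow> step \<Rightarrow> bool" where
  "passes K N x t e \<longleftrightarrow>
     (\<forall>e'. t = Some e' \<longrightarrow> (if neck_right e' \<and> neck_left e then x \<in> K else x \<in> N))"

definition enters_with_neck :: "step option \<Rightarrow> bool" where
  "enters_with_neck t \<longleftrightarrow> (\<exists>e. t = Some e \<and> neck_right e)"

text \<open>Whether a walk can be prolonged depends only on its last node and last step. The following
  predicate keeps just these data, for walks with colliders in \<open>K\<close> and noncolliders in \<open>N\<close>, so that
  walks can be handled by rule induction. The choice \<open>K = UNIV\<close>, \<open>N = {}\<close> gives collider walks, and
  \<open>K = an G C\<close>, \<open>N = - C\<close> gives the walks in the definition of \<open>\<mu>\<close>-separation.\<close>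

inductive reaches :: "'v mixed_graph \<Rightarrow> 'v set \<Rightarrow> 'v set \<Rightarrow> 'v \<Rightarrow> 'v \<Rightarrow> step option \<Rightarrow> bool"
  for G K N a where
  start: "a \<in> nodes G \<Longrightarrow> reaches G K N a a None"
| step: "\<lbrakk>reaches G K N a x t; joins G x e y; y \<in> nodes G; passes K N x t e\<rbrakk>
    \<Longrightarrow> reaches G K N a y (Some e)"

lemma reaches_None: "reaches G K N a x None \<Longrightarrow> x = a"
  by (cases rule: reaches.cases) auto

lemma reaches_in_nodes: "reaches G K N a x t \<Longrightarrow> x \<in> nodes G"
  by (induction rule: reaches.induct) auto

definition status_ok :: "'v set \<Rightarrow> 'v set \<Rightarrow> 'v list \<Rightarrow> step list \<Rightarrow> bool" where
  "status_ok K N ns es \<longleftrightarrow>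
     (\<forall>i. collider es i \<longrightarrow> ns ! i \<in> K) \<and> (\<forall>i. noncollider es i \<longrightarrow> ns ! i \<in> N)"

definition last_step :: "step list \<Rightarrow> step option" where
  "last_step es = (if es = [] then None else Some (last es))"

lemma Some_eq_last_step_iff: "Some e = last_step es \<longleftrightarrow> es \<noteq> [] \<and> last es = e"
  by (auto simp: last_step_def)

lemma status_ok_altdef:
  "status_ok K N ns es \<longleftrightarrow>
     (\<forall>i < length es. 0 < i \<longrightarrow>
       (if neck_right (es ! (i - 1)) \<and> neck_left (es ! i) then ns ! i \<in> K else ns ! i \<in> N))"
  unfolding status_ok_def collider_def noncollider_def nonendpoint_def by auto

lemma walk_from_to_snoc:
  assumes "length ns = Suc (length es)"
  shows "walk_from_to G a (ns @ [y]) (es @ [e]) z \<longleftrightarrow>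
    walk_from_to G a ns es (last ns) \<and> joins G (last ns) e y \<and> y \<in> nodes G \<and> z = y"
proof -
  have "ns \<noteq> []" using assms by auto
  moreover from this assms have "last ns = ns ! length es" by (simp add: last_conv_nth)
  moreover have "(\<forall>i < length es. joins G ((ns @ [y]) ! i) ((es @ [e]) ! i) ((ns @ [y]) ! Suc i)) \<longleftrightarrow>
      (\<forall>i < length es. joins G (ns ! i) (es ! i) (ns ! Suc i))"
    using assms by (intro all_cong) (simp add: nth_append)
  ultimately show ?thesis
    using assms
    unfolding walk_from_to_def walk_def
    by (auto simp: All_less_Suc nth_append[of ns] nth_append_length)
qed

lemma status_ok_snoc:
  assumes "length ns = Suc (length es)"
  shows "status_ok K N (ns @ [y]) (es @ [e]) \<longleftrightarrow>
    status_ok K N ns es \<and> passes K N (last ns) (last_step es) e"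
proof -
  have "ns \<noteq> []" using assms by auto
  with assms have l: "last ns = ns ! length es" by (simp add: last_conv_nth)
  let ?ok = "\<lambda>ns es i. 0 < i \<longrightarrow>
       (if neck_right (es ! (i - 1)) \<and> neck_left (es ! i) then ns ! i \<in> K else ns ! i \<in> N)"
  have "status_ok K N (ns @ [y]) (es @ [e]) \<longleftrightarrow>
      ?ok (ns @ [y]) (es @ [e]) (length es) \<and> (\<forall>i < length es. ?ok (ns @ [y]) (es @ [e]) i)"
    unfolding status_ok_altdef by (simp add: All_less_Suc)
  also have "(\<forall>i < length es. ?ok (ns @ [y]) (es @ [e]) i) \<longleftrightarrow> (\<forall>i < length es. ?ok ns es i)"
    using assms by (intro all_cong) (auto simp: nth_append)
  also have "?ok (ns @ [y]) (es @ [e]) (length es) \<longleftrightarrow> passes K N (last ns) (last_step es) e"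
    using assms l
    by (cases "es = []") (auto simp: passes_def last_step_def last_conv_nth nth_append)
  finally show ?thesis unfolding status_ok_altdef by blast
qed

lemma reaches_iff_walk:
  "reaches G K N a x t \<longleftrightarrow>
     (\<exists>ns es. walk_from_to G a ns es x \<and> status_ok K N ns es \<and> t = last_step es)"
proof
  assume "reaches G K N a x t"
  then show "\<exists>ns es. walk_from_to G a ns es x \<and> status_ok K N ns es \<and> t = last_step es"
  proof (induction rule: reaches.induct)
    case start
    then have "walk_from_to G a [a] [] a" "status_ok K N [a] []" "None = last_step []"
      by (auto simp: walk_from_to_def walk_def status_ok_altdef last_step_def)
    then show ?case by blast
  next
    case (step x t e y)
    then obtain ns es where w: "walk_from_to G a ns es x" "status_ok K N ns es" "t = last_step es"
      by blast
    have len: "length ns = Suc (length es)" and x: "last ns = x"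
      using w(1) by (auto simp: walk_from_to_def walk_def)
    have "walk_from_to G a (ns @ [y]) (es @ [e]) y"
      using w(1) step.hyps x by (simp add: walk_from_to_snoc[OF len])
    moreover have "status_ok K N (ns @ [y]) (es @ [e])"
      using w step.hyps x by (simp add: status_ok_snoc[OF len])
    ultimately show ?case by (metis last_step_def snoc_eq_iff_butlast)
  qed
next
  assume "\<exists>ns es. walk_from_to G a ns es x \<and> status_ok K N ns es \<and> t = last_step es"
  then obtain ns es where "walk_from_to G a ns es x" "status_ok K N ns es" "t = last_step es"
    by blast
  then show "reaches G K N a x t"
  proof (induction es arbitrary: ns x t rule: rev_induct)
    case Nil
    then obtain y where "ns = [y]"
      by (auto simp: walk_from_to_def walk_def length_Suc_conv)
    then show ?case
      using Nil by (auto simp: walk_from_to_def walk_def last_step_def intro: reaches.start)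
  next
    case (snoc e es)
    have "length ns = Suc (Suc (length es))"
      using snoc.prems(1) by (simp add: walk_from_to_def walk_def)
    then obtain ns' y where ns: "ns = ns' @ [y]" and len: "length ns' = Suc (length es)"
      by (metis length_Suc_conv_rev)
    have w: "walk_from_to G a ns' es (last ns')" "joins G (last ns') e y" "y \<in> nodes G" "x = y"
      using snoc.prems(1) by (auto simp: ns walk_from_to_snoc[OF len])
    have s: "status_ok K N ns' es" "passes K N (last ns') (last_step es) e"
      using snoc.prems(2) by (auto simp: ns status_ok_snoc[OF len])
    have "reaches G K N a y (Some e)"
      using reaches.step[OF snoc.IH[OF w(1) s(1) refl] w(2,3) s(2)] .
    then show ?case using w(4) snoc.prems(3) by (simp add: last_step_def)
  qed
qed

lemma collider_connected_iff_reaches: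
  "collider_connected G a b \<longleftrightarrow> (\<exists>t. reaches G UNIV {} a b t)"
  unfolding reaches_iff_walk collider_connected_def status_ok_def noncollider_def
  by (auto simp: collider_def)

text \<open>The final edge of a \<open>\<mu>\<close>-connecting walk has a tail at the node before \<open>b\<close>, so that node is a
  noncollider, or it is \<open>a\<close>, and in both cases it is outside \<open>C\<close>.\<close>

lemma mu_connecting_iff_reaches:
  assumes "b \<in> nodes G"
  shows "(\<exists>ns es. mu_connecting G C a ns es b) \<longleftrightarrow>
    a \<notin> C \<and> (\<exists>x t. reaches G (an G C) (- C) a x t \<and> x \<notin> C \<and> (x, b) \<in> directed G)"
proof -
  have "(\<exists>ns es. mu_connecting G C a ns es b) \<longleftrightarrow>
      a \<notin> C \<and> reaches G (an G C) (- C) a b (Some Forward)"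
    unfolding reaches_iff_walk mu_connecting_def status_ok_def head_right_def Some_eq_last_step_iff
      Compl_iff
    by blast
  also have "\<dots> \<longleftrightarrow>
      a \<notin> C \<and> (\<exists>x t. reaches G (an G C) (- C) a x t \<and> x \<notin> C \<and> (x, b) \<in> directed G)"
  proof (intro conj_cong refl iffI)
    assume a: "a \<notin> C"
    assume "reaches G (an G C) (- C) a b (Some Forward)"
    then obtain x t where x: "reaches G (an G C) (- C) a x t" "(x, b) \<in> directed G"
        "passes (an G C) (- C) x t Forward"
      by (cases rule: reaches.cases) auto
    have "x \<notin> C"
    proof (cases t)
      case None
      with x(1) a show ?thesis using reaches_None by metis
    next
      case (Some e)
      with x(3) show ?thesis
        by (auto simp: passes_def neck_left_def head_left_def stump_def)
    qed
    with x show "\<exists>x t. reaches G (an G C) (- C) a x t \<and> x \<notin> C \<and> (x, b) \<in> directed G"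
      by blast
  next
    assume "\<exists>x t. reaches G (an G C) (- C) a x t \<and> x \<notin> C \<and> (x, b) \<in> directed G"
    then obtain x t where x: "reaches G (an G C) (- C) a x t" "x \<notin> C" "(x, b) \<in> directed G"
      by blast
    have "passes (an G C) (- C) x t Forward"
      using x(2) by (simp add: passes_def neck_left_def head_left_def stump_def)
    with x assms show "reaches G (an G C) (- C) a b (Some Forward)"
      by (auto intro: reaches.step)
  qed
  finally show ?thesis .
qed

lemma passes_outside:
  "x \<in> N \<Longrightarrow> \<not> enters_with_neck t \<or> \<not> neck_left e \<Longrightarrow> passes K N x t e"
  by (auto simp: passes_def enters_with_neck_def)

lemma passes_collider:
  "x \<in> K \<Longrightarrow> enters_with_neck t \<Longrightarrow> neck_left e \<Longrightarrow> passes K N x t e"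
  by (auto simp: passes_def enters_with_neck_def)

lemma neck_simps [simp]:
  "neck_left Backward" "neck_left Blunt" "\<not> neck_left Forward"
  "neck_right Forward" "neck_right Blunt" "\<not> neck_right Backward"
  "enters_with_neck (Some e) \<longleftrightarrow> neck_right e" "\<not> enters_with_neck None"
  by (simp_all add: neck_left_def neck_right_def head_left_def head_right_def stump_def
      enters_with_neck_def)

section \<open>Collider connections in graphs with all loops\<close>

definition blunt_adj :: "'v mixed_graph \<Rightarrow> ('v \<times> 'v) set" where
  "blunt_adj G = {(x, y). {x, y} \<in> blunt G}"

locale loop_cDG =
  fixes G :: "'v mixed_graph"
  assumes cDG: "cDG G" and loops: "contains_all_loops G"
begin

lemma loop: "x \<in> nodes G \<Longrightarrow> (x, x) \<in> directed G"
  using loops by (simp add: contains_all_loops_def)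

lemma directed_in_nodes: "(x, y) \<in> directed G \<Longrightarrow> x \<in> nodes G \<and> y \<in> nodes G"
  using cDG by (auto simp: cDG_def)

lemma blunt_in_nodes: "{x, y} \<in> blunt G \<Longrightarrow> x \<in> nodes G \<and> y \<in> nodes G"
proof -
  assume "{x, y} \<in> blunt G"
  then obtain u v where "u \<in> nodes G" "v \<in> nodes G" "{x, y} = {u, v}"
    using cDG unfolding cDG_def by meson
  then show ?thesis by (metis insertCI empty_iff insertE)
qed

lemma induced_loop_cDG:
  assumes "A \<subseteq> nodes G"
  shows "loop_cDG (induced G A)"
proof
  show "cDG (induced G A)"
    unfolding cDG_def
  proof (intro conjI ballI)
    show "finite (nodes (induced G A))"
      using cDG assms finite_subset by (auto simp: cDG_def induced_def)
    show "directed (induced G A) \<subseteq> nodes (induced G A) \<times> nodes (induced G A)"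
      by (auto simp: induced_def)
    fix e assume "e \<in> blunt (induced G A)"
    then have "e \<in> blunt G" "e \<subseteq> A" by (auto simp: induced_def)
    then obtain a b where "a \<noteq> b" "e = {a, b}" using cDG unfolding cDG_def by meson
    with \<open>e \<subseteq> A\<close> show "\<exists>a \<in> nodes (induced G A). \<exists>b \<in> nodes (induced G A). a \<noteq> b \<and> e = {a, b}"
      by (auto simp: induced_def)
  qed
  show "contains_all_loops (induced G A)"
    using loop assms by (auto simp: contains_all_loops_def induced_def)
qed

text \<open>The loops normalize the outer edges of a collider walk. A walk starting with a blunt edge is
  preceded by the loop at \<open>a\<close>; a single edge \<open>a \<rightarrow> b\<close> is completed by the loop at \<open>b\<close>; the trivial
  walk becomes \<open>a \<rightarrow> a \<leftarrow> a\<close>.\<close>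

lemma collider_connected_iff:
  "collider_connected G a b \<longleftrightarrow>
     (\<exists>c d. (a, c) \<in> directed G \<and> (c, d) \<in> (blunt_adj G)\<^sup>* \<and> (b, d) \<in> directed G)"
proof
  assume "collider_connected G a b"
  then obtain t where t: "reaches G UNIV {} a b t"
    by (auto simp: collider_connected_iff_reaches)
  then have "\<exists>c d. (a, c) \<in> directed G \<and> (c, d) \<in> (blunt_adj G)\<^sup>* \<and>
      (if enters_with_neck t then b = d else (b, d) \<in> directed G)"
  proof (induction rule: reaches.induct)
    case start
    then show ?case using loop by auto
  next
    case (step x t e y)
    then obtain c d where cd: "(a, c) \<in> directed G" "(c, d) \<in> (blunt_adj G)\<^sup>*"
        "if enters_with_neck t then x = d else (x, d) \<in> directed G"
      by blast
    show ?case
    proof (cases t)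
      case None
      then have "x = a" using step.hyps(1) reaches_None by metis
      moreover have "(x, x) \<in> directed G" "(y, y) \<in> directed G"
        using loop step.hyps(1,3) reaches_in_nodes by metis+
      ultimately show ?thesis
        using step.hyps(2) by (cases e) (auto simp: blunt_adj_def)
    next
      case (Some e')
      then have n: "neck_right e'" "neck_left e"
        using step.hyps(4) by (auto simp: passes_def split: if_splits)
      then have "x = d" using cd(3) Some by simp
      then show ?thesis
        using n step.hyps(2) cd by (cases e) (auto simp: blunt_adj_def intro: rtrancl_into_rtrancl)
    qed
  qed
  moreover have "(b, b) \<in> directed G" using loop t reaches_in_nodes by metis
  ultimately show "\<exists>c d. (a, c) \<in> directed G \<and> (c, d) \<in> (blunt_adj G)\<^sup>* \<and> (b, d) \<in> directed G"
    by metis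
next
  assume "\<exists>c d. (a, c) \<in> directed G \<and> (c, d) \<in> (blunt_adj G)\<^sup>* \<and> (b, d) \<in> directed G"
  then obtain c d where ac: "(a, c) \<in> directed G" and cd: "(c, d) \<in> (blunt_adj G)\<^sup>*"
      and bd: "(b, d) \<in> directed G"
    by blast
  have "\<exists>t. reaches G UNIV {} a d t \<and> enters_with_neck t"
    using cd
  proof (induction rule: rtrancl_induct)
    case base
    have "reaches G UNIV {} a c (Some Forward)"
      using ac directed_in_nodes by (intro reaches.step[OF reaches.start]) (auto simp: passes_def)
    then show ?case by fastforce
  next
    case (step y z)
    then obtain t where "reaches G UNIV {} a y t" "enters_with_neck t" by blast
    then have "reaches G UNIV {} a z (Some Blunt)"
      using step.hyps(2) blunt_in_nodes
      by (auto simp: blunt_adj_def intro!: reaches.step passes_collider)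
    then show ?case by fastforce
  qed
  then have "reaches G UNIV {} a b (Some Backward)"
    using bd directed_in_nodes by (auto intro!: reaches.step passes_collider)
  then show "collider_connected G a b" by (auto simp: collider_connected_iff_reaches)
qed

end

lemma (in loop_cDG) collider_connected_induced_iff:
  assumes "A \<subseteq> nodes G"
  shows "collider_connected (induced G A) a b \<longleftrightarrow>
    (\<exists>c d. (a, c) \<in> directed G \<and> a \<in> A \<and> c \<in> A \<and> (c, d) \<in> (blunt_adj (induced G A))\<^sup>* \<and>
       (b, d) \<in> directed G \<and> b \<in> A \<and> d \<in> A)"
  unfolding loop_cDG.collider_connected_iff[OF induced_loop_cDG[OF assms]]
  by (auto simp: induced_def)

lemma blunt_adj_induced: "(x, y) \<in> blunt_adj (induced G A) \<longleftrightarrow> {x, y} \<in> blunt G \<and> x \<in> A \<and> y \<in> A"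
  by (auto simp: blunt_adj_def induced_def)

section \<open>Connecting walks and chains of collider connections\<close>

definition links :: "'v mixed_graph \<Rightarrow> 'v set \<Rightarrow> 'v set \<Rightarrow> ('v \<times> 'v) set" where
  "links G A C = {(x, y). x \<notin> C \<and> y \<notin> C \<and> collider_connected (induced G A) x y}"

context loop_cDG
begin

lemma an_parent: "(x, y) \<in> directed G \<Longrightarrow> y \<in> an G C \<Longrightarrow> x \<in> an G C"
  using directed_in_nodes by (auto simp: an_def intro: converse_rtrancl_into_rtrancl)

lemma an_superset: "C \<subseteq> nodes G \<Longrightarrow> C \<subseteq> an G C"
  by (auto simp: an_def)

text \<open>The set \<open>A\<close> need not contain every node that a walk reaches, only those from which the walk
  goes on to a node of \<open>A\<close>; therefore membership in \<open>A\<close> is a premise of the chain. If the last step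
  has no neck at \<open>x\<close>, it is an edge from \<open>x\<close> to the preceding node, which lies in \<open>A\<close> since it is
  an ancestor of \<open>C\<close> or was itself entered without a neck; hence \<open>x \<in> A\<close>.
  The node \<open>z\<close> is the last noncollider, and \<open>c\<close>, \<open>d\<close> bound the blunt part traversed since then.\<close>

lemma reaches_imp_links:
  assumes A: "A \<subseteq> nodes G" "an G C \<subseteq> A" "a \<in> A" "a \<notin> C"
    and closed: "\<And>x y. (x, y) \<in> directed G \<Longrightarrow> y \<in> A \<Longrightarrow> x \<in> A"
    and "reaches G (an G C) (- C) a x t"
  shows "(\<not> enters_with_neck t \<longrightarrow> x \<in> A) \<and>
    (x \<in> A \<longrightarrow> (\<exists>z c d. (a, z) \<in> (links G A C)\<^sup>* \<and> z \<notin> C \<and> z \<in> A \<and> (z, c) \<in> directed G \<and>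
       c \<in> A \<and> (c, d) \<in> (blunt_adj (induced G A))\<^sup>* \<and> d \<in> A \<and>
       (if enters_with_neck t then x = d else (x, d) \<in> directed G)))"
    (is "_ \<and> (_ \<longrightarrow> ?chain x t)")
  using assms(6)
proof (induction rule: reaches.induct)
  case start
  then have "(a, a) \<in> directed G" by (rule loop)
  then show ?case using A by auto
next
  case (step x t e y)
  let ?B = "blunt_adj (induced G A)"
  \<comment> \<open>A node outside \<open>C\<close> ends the current link and can start the next one.\<close>
  have restart: "(a, x) \<in> (links G A C)\<^sup>*" if x: "x \<in> A" "x \<notin> C"
  proof -
    obtain z c d where z: "(a, z) \<in> (links G A C)\<^sup>*" "z \<notin> C" "z \<in> A" "(z, c) \<in> directed G"
       "c \<in> A" "(c, d) \<in> ?B\<^sup>*" "d \<in> A"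
       "if enters_with_neck t then x = d else (x, d) \<in> directed G"
      using step.IH x(1) by blast
    have "(x, d) \<in> directed G" using z(8) loop x A(1) by (auto split: if_splits)
    then have "(z, x) \<in> links G A C"
      using z x unfolding links_def collider_connected_induced_iff[OF A(1)] by blast
    with z(1) show ?thesis by (rule rtrancl_into_rtrancl)
  qed
  have out: "x \<notin> C" if "\<not> (enters_with_neck t \<and> neck_left e)"
  proof (cases t)
    case None
    then show ?thesis using step.hyps(1) A(4) reaches_None by metis
  next
    case (Some e')
    then show ?thesis using that step.hyps(4) by (auto simp: passes_def)
  qed
  have xA: "x \<in> A" if "neck_left e"
  proof (cases "enters_with_neck t")
    case True
    then have "x \<in> an G C"
      using that step.hyps(4) by (auto simp: passes_def enters_with_neck_def)
    then show ?thesis using A(2) by blast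
  next
    case False
    then show ?thesis using step.IH by blast
  qed
  show ?case
  proof (cases e)
    case Forward
    then have xy: "(x, y) \<in> directed G" using step.hyps(2) by simp
    have "?chain y (Some e)" if "y \<in> A"
    proof -
      have x: "x \<in> A" "x \<notin> C" using closed[OF xy that] out Forward by auto
      then show ?thesis using restart[OF x] xy that Forward by auto
    qed
    then show ?thesis using Forward by simp
  next
    case Backward
    then have yx: "(y, x) \<in> directed G" using step.hyps(2) by simp
    have x: "x \<in> A" using xA Backward by simp
    have "y \<in> A" using closed[OF yx x] .
    moreover have "?chain y (Some e)"
    proof (cases "enters_with_neck t")
      case True
      then obtain z c where "(a, z) \<in> (links G A C)\<^sup>*" "z \<notin> C" "z \<in> A" "(z, c) \<in> directed G"
       "c \<in> A" "(c, x) \<in> ?B\<^sup>*"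
        using step.IH x by auto
      then show ?thesis using yx x Backward by auto
    next
      case False
      then have "x \<notin> C" using out by simp
      then show ?thesis using restart x loop A(1) yx Backward by auto
    qed
    ultimately show ?thesis by blast
  next
    case Blunt
    then have xy: "{x, y} \<in> blunt G" using step.hyps(2) by simp
    have x: "x \<in> A" using xA Blunt by simp
    have "?chain y (Some e)" if y: "y \<in> A"
    proof -
      have B: "(x, y) \<in> ?B" using xy x y by (simp add: blunt_adj_induced)
      show ?thesis
      proof (cases "enters_with_neck t")
        case True
        then obtain z c where "(a, z) \<in> (links G A C)\<^sup>*" "z \<notin> C" "z \<in> A" "(z, c) \<in> directed G"
         "c \<in> A" "(c, x) \<in> ?B\<^sup>*"
          using step.IH x by auto
        then show ?thesis using B y Blunt by (auto intro: rtrancl_into_rtrancl)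
      next
        case False
        then have "x \<notin> C" using out by simp
        moreover have "(x, x) \<in> directed G" using loop x A(1) by blast
        ultimately show ?thesis using restart x B y Blunt by auto
      qed
    qed
    then show ?thesis using Blunt by simp
  qed
qed

text \<open>A directed path from a nonancestor of \<open>C\<close> avoids \<open>C\<close>, so its nodes are admissible
  noncolliders. Traversed against its direction, from \<open>a\<close>, it arrives without a neck, which leaves
  every continuation open.\<close>

lemma ancestor_of_source_reached:
  assumes "(u, a) \<in> (directed G)\<^sup>*" "a \<in> nodes G" "u \<notin> an G C" "C \<subseteq> nodes G"
  shows "\<exists>t. reaches G (an G C) (- C) a u t \<and> \<not> enters_with_neck t"
  using assms(1,3)
proof (induction rule: converse_rtrancl_induct)
  case base
  have "reaches G (an G C) (- C) a a None" using assms(2) by (rule reaches.start)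
  then show ?case by fastforce
next
  case (step y z)
  then have z: "z \<notin> an G C" using an_parent by blast
  then obtain t where "reaches G (an G C) (- C) a z t" "\<not> enters_with_neck t"
    using step.IH by blast
  moreover have "z \<notin> C" using z an_superset assms(4) by blast
  ultimately have "reaches G (an G C) (- C) a y (Some Backward)"
    using step.hyps(1) directed_in_nodes by (auto intro!: reaches.step passes_outside)
  then show ?case by fastforce
qed

lemma leave_along_directed_path:
  assumes "reaches G (an G C) (- C) a u t" "(u, b) \<in> (directed G)\<^sup>*" "u \<notin> an G C" "C \<subseteq> nodes G"
  shows "\<exists>t. reaches G (an G C) (- C) a b t \<and> b \<notin> C"
proof -
  have "(\<exists>t. reaches G (an G C) (- C) a b t) \<and> b \<notin> C"
    using assms(2)
  proof (induction rule: rtrancl_induct)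
    case base
    then show ?case using assms(1,3,4) an_superset by blast
  next
    case (step y z)
    then obtain t where "reaches G (an G C) (- C) a y t" "y \<notin> C" by blast
    then have "reaches G (an G C) (- C) a z (Some Forward)"
      using step.hyps(2) directed_in_nodes by (auto intro!: reaches.step passes_outside)
    moreover have "z \<notin> C"
    proof
      assume "z \<in> C"
      moreover have "(u, z) \<in> (directed G)\<^sup>*"
        using step.hyps by (rule rtrancl_into_rtrancl)
      ultimately have "u \<in> an G C" using assms(1) reaches_in_nodes by (auto simp: an_def)
      then show False using assms(3) by blast
    qed
    ultimately show ?case by blast
  qed
  then show ?thesis by blast
qed

text \<open>If no \<open>\<mu>\<close>-connecting walk to \<open>b\<close> exists, then no reachable nonancestor of \<open>C\<close> is an ancestor
  of \<open>b\<close>. Hence a reachable node of \<open>A\<close> is an ancestor of \<open>C\<close>, where a collider is allowed, or an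
  ancestor of \<open>a\<close>, where the walk can be rerouted. This lets every link of a chain be followed.\<close>

lemma links_imp_reaches:
  assumes ab: "a \<in> nodes G" "b \<in> nodes G" and C: "C \<subseteq> nodes G" and a: "a \<notin> C"
    and A: "A = an G (insert a (insert b C))"
    and chain: "(a, x) \<in> (links G A C)\<^sup>*"
    and noexit: "\<not> (\<exists>y t. reaches G (an G C) (- C) a y t \<and> y \<notin> C \<and> (y, b) \<in> directed G)"
  shows "\<exists>t. reaches G (an G C) (- C) a x t \<and> x \<notin> C \<and> \<not> enters_with_neck t"
  using chain
proof (induction rule: rtrancl_induct)
  case base
  have "reaches G (an G C) (- C) a a None" using ab(1) by (rule reaches.start)
  then show ?case using a by fastforce
next
  case (step x y)
  let ?R = "reaches G (an G C) (- C) a"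
  \<comment> \<open>The interior edges of a link and its last edge have a neck at the end where they are entered;
    \<open>?open u\<close> says that \<open>u\<close> is reached by some walk that may go on with any such edge.\<close>
  let ?open = "\<lambda>u. \<exists>t. ?R u t \<and> (\<forall>e. neck_left e \<longrightarrow> passes (an G C) (- C) u t e)"
  have A_nodes: "A \<subseteq> nodes G" by (auto simp: A an_def)
  have openI: "?open u" if u: "?R u t" "enters_with_neck t" "u \<in> A" for u t
  proof (cases "u \<in> an G C")
    case True
    then show ?thesis using u(1) passes_collider[OF True u(2)] by blast
  next
    case False
    have "(u, b) \<notin> (directed G)\<^sup>*"
      using leave_along_directed_path[OF u(1) _ False C] loop[OF ab(2)] noexit by blast
    then have "(u, a) \<in> (directed G)\<^sup>*"
      using u(3) False unfolding A an_def by blast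
    then obtain t' where t': "?R u t'" "\<not> enters_with_neck t'"
      using ancestor_of_source_reached ab(1) False C by blast
    have "u \<in> - C" using False an_superset C by blast
    then have "passes (an G C) (- C) u t' e" for e using t'(2) by (simp add: passes_outside)
    then show ?thesis using t'(1) by blast
  qed
  obtain c d where cd: "(x, c) \<in> directed G" "c \<in> A" "(c, d) \<in> (blunt_adj (induced G A))\<^sup>*"
      "(y, d) \<in> directed G" and y: "y \<notin> C"
    using step.hyps(2) unfolding links_def collider_connected_induced_iff[OF A_nodes] by blast
  obtain t where "?R x t" "x \<notin> C" using step.IH by blast
  then have c: "?R c (Some Forward)"
    using cd(1) directed_in_nodes by (auto intro!: reaches.step passes_outside)
  have "?open d"
    using cd(3)
  proof (induction rule: rtrancl_induct)
    case base
    show ?case using openI[OF c] cd(2) by simp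
  next
    case (step u v)
    then obtain t where t: "?R u t" "passes (an G C) (- C) u t Blunt" by auto
    have uv: "{u, v} \<in> blunt G" "v \<in> A" using step.hyps(2) by (auto simp: blunt_adj_induced)
    then have "?R v (Some Blunt)"
      using t A_nodes by (auto intro: reaches.step)
    then show ?case using openI uv(2) by simp
  qed
  then obtain t where "?R d t" "passes (an G C) (- C) d t Backward" by auto
  then have "?R y (Some Backward)"
    using cd(4) directed_in_nodes by (auto intro: reaches.step)
  then show ?case using y by fastforce
qed

theorem mu_connecting_iff_links:
  assumes "a \<in> nodes G" "b \<in> nodes G" "C \<subseteq> nodes G"
    and A: "A = an G (insert a (insert b C))"
  shows "(\<exists>ns es. mu_connecting G C a ns es b) \<longleftrightarrow>
    a \<notin> C \<and> (a, b) \<in> (links G A C)\<^sup>* O directed G"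
  unfolding mu_connecting_iff_reaches[OF assms(2)]
proof (intro conj_cong refl iffI)
  assume a: "a \<notin> C"
  have sub: "A \<subseteq> nodes G" "an G C \<subseteq> A" "a \<in> A" "b \<in> A"
    using assms(1,2) by (auto simp: A an_def)
  assume "\<exists>x t. reaches G (an G C) (- C) a x t \<and> x \<notin> C \<and> (x, b) \<in> directed G"
  then obtain x t where x: "reaches G (an G C) (- C) a x t" "x \<notin> C" "(x, b) \<in> directed G"
    by blast
  have "x \<in> A" using an_parent[OF x(3)] sub(4) by (simp add: A)
  then obtain z c d where z: "(a, z) \<in> (links G A C)\<^sup>*" "z \<notin> C" "z \<in> A" "(z, c) \<in> directed G"
      "c \<in> A" "(c, d) \<in> (blunt_adj (induced G A))\<^sup>*" "d \<in> A"
      "if enters_with_neck t then x = d else (x, d) \<in> directed G"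
    using reaches_imp_links[OF sub(1-3) a _ x(1)] an_parent unfolding A by blast
  have "(x, d) \<in> directed G" using z(8) loop \<open>x \<in> A\<close> sub(1) by (auto split: if_splits)
  then have "(z, x) \<in> links G A C"
    using z x \<open>x \<in> A\<close> unfolding links_def collider_connected_induced_iff[OF sub(1)] by blast
  then show "(a, b) \<in> (links G A C)\<^sup>* O directed G"
    using z(1) x(3) by (meson relcomp.relcompI rtrancl_into_rtrancl)
next
  assume a: "a \<notin> C"
  assume "(a, b) \<in> (links G A C)\<^sup>* O directed G"
  then obtain x where x: "(a, x) \<in> (links G A C)\<^sup>*" "(x, b) \<in> directed G" by blast
  show "\<exists>x t. reaches G (an G C) (- C) a x t \<and> x \<notin> C \<and> (x, b) \<in> directed G"
    using links_imp_reaches[OF assms(1,2,3) a A x(1)] x(2) by blast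
qed

end

section \<open>Markov equivalence\<close>

lemma markov_equivalent_iff:
  assumes "nodes G = nodes H"
  shows "markov_equivalent G H \<longleftrightarrow>
    (\<forall>a \<in> nodes G. \<forall>b \<in> nodes G. \<forall>C. C \<subseteq> nodes G \<longrightarrow>
      (\<exists>ns es. mu_connecting G C a ns es b) = (\<exists>ns es. mu_connecting H C a ns es b))"
    (is "_ \<longleftrightarrow> ?same")
proof
  assume eq: "markov_equivalent G H"
  show ?same
  proof (intro ballI allI impI)
    fix a b C assume "a \<in> nodes G" "b \<in> nodes G" "C \<subseteq> nodes G"
    moreover have "({a}, {b}, C) \<in> independence_model G \<longleftrightarrow> ({a}, {b}, C) \<in> independence_model H"
      using eq by (simp add: markov_equivalent_def)
    ultimately show "(\<exists>ns es. mu_connecting G C a ns es b) = (\<exists>ns es. mu_connecting H C a ns es b)"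
      using assms by (auto simp: independence_model_def mu_separated_def)
  qed
next
  assume ?same
  then have "mu_separated G A B C \<longleftrightarrow> mu_separated H A B C"
    if "A \<subseteq> nodes G" "B \<subseteq> nodes G" "C \<subseteq> nodes G" for A B C
    using that unfolding mu_separated_def by (meson subsetD)
  then show "markov_equivalent G H"
    using assms unfolding markov_equivalent_def independence_model_def by auto
qed

lemma collider_connected_induced_nodes:
  "collider_connected (induced G A) x y \<Longrightarrow> x \<in> A \<and> y \<in> A"
  unfolding collider_connected_def walk_from_to_def walk_def induced_def
  by (metis hd_in_set last_in_set length_greater_0_conv mixed_graph.select_convs(1) subsetD zero_less_Suc)

text \<open>Only \<open>a\<close> and \<open>b\<close> are available as nodes of a chain, so a chain consists of steps between these
  two, and its final directed edge is itself a collider connection.\<close>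

lemma (in loop_cDG) mu_connecting_given_rest_iff:
  assumes A: "ancestral G A" and ab: "a \<in> A" "b \<in> A"
  shows "(\<exists>ns es. mu_connecting G (A - {a, b}) a ns es b) \<longleftrightarrow> collider_connected (induced G A) a b"
proof -
  let ?C = "A - {a, b}"
  have sub: "A \<subseteq> nodes G" and an: "A = an G A" using A by (auto simp: ancestral_def)
  have "insert a (insert b ?C) = A" using ab by blast
  then have gen: "A = an G (insert a (insert b ?C))" using an by simp
  have ab': "a \<in> nodes G" "b \<in> nodes G" "?C \<subseteq> nodes G" using ab sub by auto
  have "(a, b) \<in> (links G A ?C)\<^sup>* O directed G \<longleftrightarrow> collider_connected (induced G A) a b"
  proof
    assume "(a, b) \<in> (links G A ?C)\<^sup>* O directed G"
    then obtain x where x: "(a, x) \<in> (links G A ?C)\<^sup>*" "(x, b) \<in> directed G" by blast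
    have "x = a \<or> x = b \<and> (a, b) \<in> links G A ?C"
      using x(1)
    proof (induction rule: rtrancl_induct)
      case (step y z)
      then have "z = a \<or> z = b"
        using collider_connected_induced_nodes[of G A y z] by (auto simp: links_def)
      then show ?case using step by auto
    qed simp
    then show "collider_connected (induced G A) a b"
    proof
      assume "x = a"
      then have "(a, b) \<in> directed G" "(b, b) \<in> directed G" using x(2) loop ab'(2) by auto
      then show ?thesis
        using ab unfolding collider_connected_induced_iff[OF sub] by blast
    qed (simp add: links_def)
  next
    assume "collider_connected (induced G A) a b"
    then have "(a, b) \<in> links G A ?C" by (simp add: links_def)
    then show "(a, b) \<in> (links G A ?C)\<^sup>* O directed G" using loop ab'(2) by blast
  qed
  then show ?thesis using mu_connecting_iff_links[OF ab' gen] by simp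
qed

theorem theorem36:
  fixes D1 D2 :: "'v mixed_graph"
  assumes "cDG D1" and "cDG D2"
    and "nodes D1 = nodes D2"
    and "contains_all_loops D1" and "contains_all_loops D2"
    and "directed D1 = directed D2"
  shows "markov_equivalent D1 D2 \<longleftrightarrow>
    (\<forall>A. ancestral D1 A \<longrightarrow> same_collider_connections (induced D1 A) (induced D2 A))"
proof -
  interpret G1: loop_cDG D1 using assms by unfold_locales
  interpret G2: loop_cDG D2 using assms by unfold_locales
  have an: "an D2 = an D1" using assms by (auto simp: an_def fun_eq_iff)
  have anc: "ancestral D2 A \<longleftrightarrow> ancestral D1 A" for A
    using assms(3) an by (simp add: ancestral_def)
  show ?thesis
    unfolding markov_equivalent_iff[OF assms(3)]
  proof (rule iffI; intro allI ballI impI)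
    fix A
    assume same: "\<forall>a \<in> nodes D1. \<forall>b \<in> nodes D1. \<forall>C. C \<subseteq> nodes D1 \<longrightarrow>
        (\<exists>ns es. mu_connecting D1 C a ns es b) = (\<exists>ns es. mu_connecting D2 C a ns es b)"
      and A: "ancestral D1 A"
    have sub: "A \<subseteq> nodes D1" using A by (simp add: ancestral_def)
    have "collider_connected (induced D1 A) a b \<longleftrightarrow> collider_connected (induced D2 A) a b"
      if "a \<in> A" "b \<in> A" for a b
    proof -
      have "A - {a, b} \<subseteq> nodes D1" "a \<in> nodes D1" "b \<in> nodes D1" using sub that by auto
      then show ?thesis
        using same G1.mu_connecting_given_rest_iff[OF A that]
          G2.mu_connecting_given_rest_iff[OF A[folded anc] that] by blast
    qed
    then show "same_collider_connections (induced D1 A) (induced D2 A)"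
      by (simp add: same_collider_connections_def induced_def)
  next
    fix a b C
    assume same: "\<forall>A. ancestral D1 A \<longrightarrow> same_collider_connections (induced D1 A) (induced D2 A)"
      and ab: "a \<in> nodes D1" "b \<in> nodes D1" "C \<subseteq> nodes D1"
    define A where "A = an D1 (insert a (insert b C))"
    have "ancestral D1 A"
      by (auto simp: ancestral_def A_def an_def intro: rtrancl_trans)
    then have "collider_connected (induced D1 A) x y \<longleftrightarrow> collider_connected (induced D2 A) x y"
      if "x \<in> A" "y \<in> A" for x y
      using same that by (auto simp: same_collider_connections_def induced_def)
    then have "links D1 A C = links D2 A C"
      using collider_connected_induced_nodes unfolding links_def by fast
    moreover have "A = an D2 (insert a (insert b C))" by (simp add: an A_def)
    ultimately show
      "(\<exists>ns es. mu_connecting D1 C a ns es b) = (\<exists>ns es. mu_connecting D2 C a ns es b)"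
      using G1.mu_connecting_iff_links[OF ab A_def]
        G2.mu_connecting_iff_links[of a b C A] ab assms(3,6) by simp
  qed
qed

end
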